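(* Consider $M=\mathbb R^2$ endowed with its canonical affine structure (the canonical flat connection $\nabla$) and a Riemannian metric $\langle\cdot,\cdot\rangle=\begin{pmatrix}\mu_{11}&\mu_{12}\\ \mu_{12}&\mu_{22}\end{pmatrix}$ in the canonical coordinates $(x_1,x_2)$. Then the canonical Hermitian structure $(TM,J_1,g_1)$ is balanced if and only if there exist smooth functions $\nu:\mathbb R^2\to\mathbb R$ and $f,h:\mathbb R\to\mathbb R$ such that $$\mu_{12}=\nu,\qquad \mu_{11}(x_1,x_2)=f(x_1)+\int\frac{\partial\nu}{\partial x_1}(x_1,x_2)\,dx_2,\qquad \mu_{22}(x_1,x_2)=h(x_2)+\int\frac{\partial\nu}{\partial x_2}(x_1,x_2)\,dx_1.$$ Here $\int\frac{\partial\nu}{\partial x_1}(x_1,x_2)\,dx_2$ and $\int\frac{\partial\nu}{\partial x_2}(x_1,x_2)\,dx_1$ denote the primitives $\int_0^{x_2}\frac{\partial\nu}{\partial x_1}(x_1,t)\,dt$ and $\int_0^{x_1}\frac{\partial\nu}{\partial x_2}(t,x_2)\,dt$.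
   Context: Let $(M,\nabla,\langle\cdot,\cdot\rangle)$ be a manifold with a flat torsionless connection $\nabla$ and a Riemannian metric. Canonical Hermitian structure on $TM$: $\pi_1:TM\to M$ is the projection; for a vector field $X$ on $M$, $X^h$ is the horizontal lift with respect to $\nabla$ and $X^v$ the vertical lift; $J_1X^h=X^v$, $J_1X^v=-X^h$; $g_1(X^h,Y^h)=g_1(X^v,Y^v)=\langle X,Y\rangle\circ\pi_1$, $g_1(X^h,Y^v)=0$. (For $M=\mathbb R^2$ with its canonical connection, $TM=\mathbb R^4$ with coordinates $(x_1,x_2,u_1,u_2)$, $\partial_{x_i}^h=\partial_{x_i}$, $\partial_{x_i}^v=\partial_{u_i}$.) For a Hermitian manifold $(N,J,g)$ with Levi-Civita connection $\nabla^{LC}$: $\omega=g(J\cdot,\cdot)$, $d^*\omega(\cdot)=-\sum_i(\nabla^{LC}_{E_i}\omega)(E_i,\cdot)$ for a local $g$-orthonormal frame, Lee form $\theta=-d^*\omega\circ J$; it is balanced if $\theta=0$. *)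

theory Defs
  imports "HOL-Analysis.Analysis"
begin

(* C^k maps between finite-dimensional spaces: f is C^(k+1) iff it is differentiable and all
   its directional derivatives are C^k. *)
primrec Ck :: "nat \<Rightarrow> ('a::euclidean_space \<Rightarrow> 'b::euclidean_space) \<Rightarrow> bool" where
  "Ck 0 f \<longleftrightarrow> continuous_on UNIV f"
| "Ck (Suc k) f \<longleftrightarrow> (\<forall>x. f differentiable (at x)) \<and>
      (\<forall>v. Ck k (\<lambda>x. frechet_derivative f (at x) v))"

definition smooth :: "('a::euclidean_space \<Rightarrow> 'b::euclidean_space) \<Rightarrow> bool" where
  "smooth f \<longleftrightarrow> (\<forall>k. Ck k f)"

definition riemannian_metric :: "('a::euclidean_space \<Rightarrow> 'a \<Rightarrow> 'a \<Rightarrow> real) \<Rightarrow> bool" where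
  "riemannian_metric g \<longleftrightarrow>
     (\<forall>x. bilinear (g x)) \<and>
     (\<forall>x v w. g x v w = g x w v) \<and>
     (\<forall>x v. v \<noteq> 0 \<longrightarrow> 0 < g x v v) \<and>
     (\<forall>v w. smooth (\<lambda>x. g x v w))"

(* Vector fields on the space 'a are functions 'a => 'a; only smooth ones are meaningful as
   arguments of a connection. *)

definition along :: "('a::euclidean_space \<Rightarrow> 'a) \<Rightarrow> ('a \<Rightarrow> 'b::euclidean_space) \<Rightarrow> 'a \<Rightarrow> 'b" where
  "along X f x = frechet_derivative f (at x) (X x)"

definition lie_bracket :: "('a::euclidean_space \<Rightarrow> 'a) \<Rightarrow> ('a \<Rightarrow> 'a) \<Rightarrow> 'a \<Rightarrow> 'a" where
  "lie_bracket X Y x = along X Y x - along Y X x"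

type_synonym 'a connection = "('a \<Rightarrow> 'a) \<Rightarrow> ('a \<Rightarrow> 'a) \<Rightarrow> 'a \<Rightarrow> 'a"

definition affine_connection :: "'a::euclidean_space connection \<Rightarrow> bool" where
  "affine_connection D \<longleftrightarrow>
     (\<forall>X Y. smooth X \<longrightarrow> smooth Y \<longrightarrow> smooth (D X Y)) \<and>
     (\<forall>X X' Y. smooth X \<longrightarrow> smooth X' \<longrightarrow> smooth Y \<longrightarrow>
        D (\<lambda>x. X x + X' x) Y = (\<lambda>x. D X Y x + D X' Y x)) \<and>
     (\<forall>\<phi> X Y. smooth \<phi> \<longrightarrow> smooth X \<longrightarrow> smooth Y \<longrightarrow>
        D (\<lambda>x. \<phi> x *\<^sub>R X x) Y = (\<lambda>x. \<phi> x *\<^sub>R D X Y x)) \<and>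
     (\<forall>X Y Y'. smooth X \<longrightarrow> smooth Y \<longrightarrow> smooth Y' \<longrightarrow>
        D X (\<lambda>x. Y x + Y' x) = (\<lambda>x. D X Y x + D X Y' x)) \<and>
     (\<forall>\<phi> X Y. smooth \<phi> \<longrightarrow> smooth X \<longrightarrow> smooth Y \<longrightarrow>
        D X (\<lambda>x. \<phi> x *\<^sub>R Y x) = (\<lambda>x. \<phi> x *\<^sub>R D X Y x + along X \<phi> x *\<^sub>R Y x))"

definition torsion_free :: "'a::euclidean_space connection \<Rightarrow> bool" where
  "torsion_free D \<longleftrightarrow>
     (\<forall>X Y. smooth X \<longrightarrow> smooth Y \<longrightarrow> (\<forall>x. D X Y x - D Y X x = lie_bracket X Y x))"

definition metric_connection ::
    "('a::euclidean_space \<Rightarrow> 'a \<Rightarrow> 'a \<Rightarrow> real) \<Rightarrow> 'a connection \<Rightarrow> bool" where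
  "metric_connection g D \<longleftrightarrow>
     (\<forall>X Y Z. smooth X \<longrightarrow> smooth Y \<longrightarrow> smooth Z \<longrightarrow>
        (\<forall>x. along X (\<lambda>y. g y (Y y) (Z y)) x = g x (D X Y x) (Z x) + g x (Y x) (D X Z x)))"

(* The conditions determine the connection on smooth vector fields only, so SOME rather than
   THE is used; the values on non-smooth fields are irrelevant. *)
definition levi_civita :: "('a::euclidean_space \<Rightarrow> 'a \<Rightarrow> 'a \<Rightarrow> real) \<Rightarrow> 'a connection" where
  "levi_civita g = (SOME D. affine_connection D \<and> torsion_free D \<and> metric_connection g D)"

definition cov_deriv2 ::
    "'a::euclidean_space connection \<Rightarrow> ('a \<Rightarrow> 'a \<Rightarrow> 'a \<Rightarrow> real) \<Rightarrow>
     ('a \<Rightarrow> 'a) \<Rightarrow> ('a \<Rightarrow> 'a) \<Rightarrow> ('a \<Rightarrow> 'a) \<Rightarrow> 'a \<Rightarrow> real" where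
  "cov_deriv2 D \<omega> X Y Z x =
     along X (\<lambda>y. \<omega> y (Y y) (Z y)) x - \<omega> x (D X Y x) (Z x) - \<omega> x (Y x) (D X Z x)"

(* The frame is indexed by the standard basis of the model space. On R^n there are global
   smooth orthonormal frames (Gram-Schmidt applied to the coordinate frame), so frames are
   taken to be global. *)
definition orthonormal_frame ::
    "('a::euclidean_space \<Rightarrow> 'a \<Rightarrow> 'a \<Rightarrow> real) \<Rightarrow> ('a \<Rightarrow> 'a \<Rightarrow> 'a) \<Rightarrow> bool" where
  "orthonormal_frame g E \<longleftrightarrow>
     (\<forall>i\<in>Basis. smooth (E i)) \<and>
     (\<forall>i\<in>Basis. \<forall>j\<in>Basis. \<forall>x. g x (E i x) (E j x) = (if i = j then 1 else 0))"

(* The value does not depend on the chosen frame. *)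
definition codifferential ::
    "('a::euclidean_space \<Rightarrow> 'a \<Rightarrow> 'a \<Rightarrow> real) \<Rightarrow> ('a \<Rightarrow> 'a \<Rightarrow> 'a \<Rightarrow> real) \<Rightarrow>
     ('a \<Rightarrow> 'a) \<Rightarrow> 'a \<Rightarrow> real" where
  "codifferential g \<omega> Z x =
     (let E = (SOME E. orthonormal_frame g E)
      in - (\<Sum>i\<in>Basis. cov_deriv2 (levi_civita g) \<omega> (E i) (E i) Z x))"

definition fundamental_form ::
    "('a::euclidean_space \<Rightarrow> 'a \<Rightarrow> 'a) \<Rightarrow> ('a \<Rightarrow> 'a \<Rightarrow> 'a \<Rightarrow> real) \<Rightarrow> 'a \<Rightarrow> 'a \<Rightarrow> 'a \<Rightarrow> real" where
  "fundamental_form J g x v w = g x (J x v) w"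

definition lee_form ::
    "('a::euclidean_space \<Rightarrow> 'a \<Rightarrow> 'a) \<Rightarrow> ('a \<Rightarrow> 'a \<Rightarrow> 'a \<Rightarrow> real) \<Rightarrow> ('a \<Rightarrow> 'a) \<Rightarrow> 'a \<Rightarrow> real" where
  "lee_form J g Z x = - codifferential g (fundamental_form J g) (\<lambda>y. J y (Z y)) x"

definition balanced ::
    "('a::euclidean_space \<Rightarrow> 'a \<Rightarrow> 'a) \<Rightarrow> ('a \<Rightarrow> 'a \<Rightarrow> 'a \<Rightarrow> real) \<Rightarrow> bool" where
  "balanced J g \<longleftrightarrow> (\<forall>Z. smooth Z \<longrightarrow> (\<forall>x. lee_form J g Z x = 0))"

(* For M = 'a the tangent bundle TM is 'a * 'a, a point being (x, u) with u tangent at x.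
   A curve (x(t), u(t)) is horizontal iff u' + D_{x'} u = 0 with u extended constantly. *)

definition hlift :: "'a::euclidean_space connection \<Rightarrow> 'a \<times> 'a \<Rightarrow> 'a \<Rightarrow> 'a \<times> 'a" where
  "hlift D p a = (a, - D (\<lambda>_. a) (\<lambda>_. snd p) (fst p))"

definition vlift :: "'a::euclidean_space \<times> 'a \<Rightarrow> 'a \<Rightarrow> 'a \<times> 'a" where
  "vlift p a = (0, a)"

(* A tangent vector w of TM at p is hlift D p (fst w) + vlift p (vpart D p w). *)
definition vpart :: "'a::euclidean_space connection \<Rightarrow> 'a \<times> 'a \<Rightarrow> 'a \<times> 'a \<Rightarrow> 'a" where
  "vpart D p w = snd w + D (\<lambda>_. fst w) (\<lambda>_. snd p) (fst p)"

definition J1 :: "'a::euclidean_space connection \<Rightarrow> 'a \<times> 'a \<Rightarrow> 'a \<times> 'a \<Rightarrow> 'a \<times> 'a" where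
  "J1 D p w = vlift p (fst w) - hlift D p (vpart D p w)"

definition g1 ::
    "'a::euclidean_space connection \<Rightarrow> ('a \<Rightarrow> 'a \<Rightarrow> 'a \<Rightarrow> real) \<Rightarrow>
     'a \<times> 'a \<Rightarrow> 'a \<times> 'a \<Rightarrow> 'a \<times> 'a \<Rightarrow> real" where
  "g1 D m p v w = m (fst p) (fst v) (fst w) + m (fst p) (vpart D p v) (vpart D p w)"

definition canonical_connection :: "'a::euclidean_space connection" where
  "canonical_connection X Y = along X Y"

lemma Ck_const: "Ck k (\<lambda>_. c)"
  by (induction k arbitrary: c) auto

lemma smooth_const: "smooth (\<lambda>_. c)"
  by (simp add: smooth_def Ck_const)

lemma connection_zero:
  assumes "affine_connection D" "smooth Y"
  shows "D (\<lambda>_. 0) Y x = 0"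
proof -
  have "D (\<lambda>x. (0::real) *\<^sub>R 0) Y = (\<lambda>x. 0 *\<^sub>R D (\<lambda>_. 0) Y x)"
    using assms(1)[unfolded affine_connection_def, THEN conjunct2, THEN conjunct2, THEN conjunct1,
        rule_format, of "\<lambda>_. 0" "\<lambda>_. 0" Y] assms(2)
    by (simp add: smooth_const)
  then show ?thesis
    by (simp add: fun_eq_iff)
qed

lemma tangent_decomposition: "w = hlift D p (fst w) + vlift p (vpart D p w)"
  by (cases w) (simp add: hlift_def vlift_def vpart_def)

lemma vpart_hlift: "vpart D p (hlift D p a) = 0"
  by (simp add: vpart_def hlift_def)

lemma vpart_vlift:
  assumes "affine_connection D"
  shows "vpart D p (vlift p a) = a"
  by (simp add: vpart_def vlift_def connection_zero[OF assms smooth_const])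

lemma J1_lifts:
  assumes "affine_connection D"
  shows "J1 D p (hlift D p a) = vlift p a" "J1 D p (vlift p a) = - hlift D p a"
proof -
  have "hlift D p 0 = 0"
    by (simp add: hlift_def connection_zero[OF assms smooth_const] zero_prod_def)
  then show "J1 D p (hlift D p a) = vlift p a"
    by (simp add: J1_def vpart_hlift) (simp add: hlift_def)
  show "J1 D p (vlift p a) = - hlift D p a"
    by (simp add: J1_def vpart_vlift[OF assms]) (simp add: vlift_def zero_prod_def[symmetric])
qed

lemma g1_lifts:
  assumes "affine_connection D" "riemannian_metric m"
  shows "g1 D m p (hlift D p a) (hlift D p b) = m (fst p) a b"
    and "g1 D m p (vlift p a) (vlift p b) = m (fst p) a b"
    and "g1 D m p (hlift D p a) (vlift p b) = 0"
proof -
  have "bilinear (m (fst p))"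
    using assms(2) by (simp add: riemannian_metric_def)
  then have "m (fst p) 0 v = 0" "m (fst p) v 0 = 0" for v
    by (simp_all add: bilinear_lzero bilinear_rzero)
  moreover have "fst (hlift D p v) = v" "fst (vlift p v) = 0" for v
    by (simp_all add: hlift_def vlift_def)
  ultimately show "g1 D m p (hlift D p a) (hlift D p b) = m (fst p) a b"
    and "g1 D m p (vlift p a) (vlift p b) = m (fst p) a b"
    and "g1 D m p (hlift D p a) (vlift p b) = 0"
    by (simp_all add: g1_def vpart_hlift vpart_vlift[OF assms(1)])
qed

lemma hlift_canonical: "hlift canonical_connection p a = (a, 0)"
  by (simp add: hlift_def canonical_connection_def along_def)

definition metric_of ::
    "(real^2 \<Rightarrow> real) \<Rightarrow> (real^2 \<Rightarrow> real) \<Rightarrow> (real^2 \<Rightarrow> real) \<Rightarrow> real^2 \<Rightarrow> real^2 \<Rightarrow> real^2 \<Rightarrow> real" where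
  "metric_of \<mu>11 \<mu>12 \<mu>22 x v w =
     v \<bullet> ((vector [vector [\<mu>11 x, \<mu>12 x], vector [\<mu>12 x, \<mu>22 x]] :: real^2^2) *v w)"

definition partial :: "'n::finite \<Rightarrow> (real^'n \<Rightarrow> real) \<Rightarrow> real^'n \<Rightarrow> real" where
  "partial i f x = frechet_derivative f (at x) (axis i 1)"

end

theory Submission
  imports Defs
begin

text \<open>
  The Levi-Civita connection of a metric \<open>g\<close> on the model space is the flat connection plus Christoffel
  terms, which the Koszul formula expresses through a global orthonormal frame. For a constant
  \<open>g\<close>-orthogonal complex structure this gives the Lee form
  \<open>\<theta>(Z) = 1/2 \<Sum>\<^sub>i (\<partial>\<^sub>Z g)(e\<^sub>i, e\<^sub>i) - \<Sum>\<^sub>i (\<partial>\<^bsub>e\<^sub>i\<^esub> g)(e\<^sub>i, Z)\<close>, a trace that may be taken in any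
  orthonormal basis \<open>e\<close>. On \<open>TM\<close> with \<open>M\<close> the plane, the basis made of horizontal and vertical lifts
  shows that \<open>\<theta>\<close> vanishes iff \<open>\<partial>\<^sub>2 \<mu>\<^sub>1\<^sub>1 = \<partial>\<^sub>1 \<mu>\<^sub>1\<^sub>2\<close> and \<open>\<partial>\<^sub>1 \<mu>\<^sub>2\<^sub>2 = \<partial>\<^sub>2 \<mu>\<^sub>1\<^sub>2\<close>, i.e. iff the metric is
  Hessian; integrating these two equations gives the stated form.
\<close>

section \<open>Smooth functions and fields of bilinear forms\<close>

text \<open>\<open>frechet_derivative\<close> is a choice term; uniqueness of derivatives identifies
  it with any explicit candidate \<open>f'\<close>, so the regularity inductions below can use the
  derivative rules directly.\<close>

lemma Ck_SucI:
  assumes "\<And>x. (f has_derivative f' x) (at x)" and "\<And>v. Ck k (\<lambda>x. f' x v)"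
  shows "Ck (Suc k) f"
proof -
  have "frechet_derivative f (at x) = f' x" for x
    using frechet_derivative_at[OF assms(1)] by simp
  then show ?thesis
    using assms by (auto simp: differentiable_def)
qed

lemma Ck_SucD:
  assumes "Ck (Suc k) f"
  shows "(f has_derivative frechet_derivative f (at x)) (at x)"
    and "Ck k (\<lambda>x. frechet_derivative f (at x) v)"
  using assms by (simp_all add: frechet_derivative_works[symmetric])

lemma Ck_Suc_imp_Ck: "Ck (Suc k) f \<Longrightarrow> Ck k f"
proof (induction k arbitrary: f)
  case 0
  then show ?case
    by (auto simp: continuous_on_eq_continuous_at differentiable_imp_continuous_within)
next
  case (Suc k)
  show ?case
    by (intro Ck_SucI[OF Ck_SucD(1)[OF Suc.prems]] Suc.IH[OF Ck_SucD(2)[OF Suc.prems]])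
qed

lemma Ck_add:
  assumes "Ck k f" "Ck k g"
  shows "Ck k (\<lambda>x. f x + g x)"
  using assms
proof (induction k arbitrary: f g)
  case 0
  then show ?case by (auto intro: continuous_on_add)
next
  case (Suc k)
  show ?case
    by (rule Ck_SucI[OF has_derivative_add[OF Ck_SucD(1)[OF Suc.prems(1)] Ck_SucD(1)[OF Suc.prems(2)]]])
      (intro Suc.IH Ck_SucD(2)[OF Suc.prems(1)] Ck_SucD(2)[OF Suc.prems(2)])
qed

text \<open>The Leibniz rule produces a sum of two products of the same shape, hence the induction
  with \<open>f\<close> and \<open>g\<close> arbitrary. The undifferentiated factor drops one order
  by \<open>Ck_Suc_imp_Ck\<close>.\<close>

lemma Ck_bounded_bilinear:
  assumes "bounded_bilinear pr" "Ck k f" "Ck k g"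
  shows "Ck k (\<lambda>x. pr (f x) (g x))"
  using assms(2,3)
proof (induction k arbitrary: f g)
  case 0
  then show ?case
    using bounded_bilinear.continuous_on[OF assms(1)] by auto
next
  case (Suc k)
  show ?case
    by (rule Ck_SucI[OF bounded_bilinear.FDERIV[OF assms(1) Ck_SucD(1)[OF Suc.prems(1)]
            Ck_SucD(1)[OF Suc.prems(2)]]])
      (intro Ck_add Suc.IH Ck_SucD(2)[OF Suc.prems(1)] Ck_SucD(2)[OF Suc.prems(2)]
        Suc.prems[THEN Ck_Suc_imp_Ck])
qed

lemma Ck_compose_linear:
  assumes "bounded_linear L" "Ck k f"
  shows "Ck k (\<lambda>x. f (L x))"
  using assms(2)
proof (induction k arbitrary: f)
  case 0
  then show ?case
    using continuous_on_compose2[of UNIV f UNIV L] linear_continuous_on[OF assms(1)] by auto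
next
  case (Suc k)
  show ?case
  proof (rule Ck_SucI)
    show "((\<lambda>x. f (L x)) has_derivative (\<lambda>v. frechet_derivative f (at (L x)) (L v))) (at x)" for x
      using has_derivative_compose[OF bounded_linear_imp_has_derivative[OF assms(1)] Ck_SucD(1)[OF Suc.prems]] .
    show "Ck k (\<lambda>x. frechet_derivative f (at (L x)) (L v))" for v
      by (rule Suc.IH[OF Ck_SucD(2)[OF Suc.prems]])
  qed
qed

lemma smooth_has_derivative:
  "smooth f \<Longrightarrow> (f has_derivative frechet_derivative f (at x)) (at x)"
  unfolding smooth_def using Ck_SucD(1) by blast

lemma smooth_frechet_derivative: "smooth f \<Longrightarrow> smooth (\<lambda>x. frechet_derivative f (at x) v)"
  unfolding smooth_def using Ck_SucD(2) by blast

lemma smooth_continuous: "smooth f \<Longrightarrow> continuous_on UNIV f"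
  unfolding smooth_def using Ck.simps(1) by blast

lemma smooth_add: "smooth f \<Longrightarrow> smooth g \<Longrightarrow> smooth (\<lambda>x. f x + g x)"
  by (simp add: smooth_def Ck_add)

lemma smooth_sum: "(\<And>i. i \<in> I \<Longrightarrow> smooth (f i)) \<Longrightarrow> smooth (\<lambda>x. \<Sum>i\<in>I. f i x)"
  by (induction I rule: infinite_finite_induct) (simp_all add: smooth_const smooth_add)

lemma smooth_scaleR: "smooth f \<Longrightarrow> smooth g \<Longrightarrow> smooth (\<lambda>x. f x *\<^sub>R g x)"
  by (simp add: smooth_def Ck_bounded_bilinear[OF bounded_bilinear_scaleR])

lemma smooth_mult:
  fixes f g :: "'a::euclidean_space \<Rightarrow> real"
  shows "smooth f \<Longrightarrow> smooth g \<Longrightarrow> smooth (\<lambda>x. f x * g x)"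
  using smooth_scaleR[of f g] by simp

lemma smooth_inner: "smooth f \<Longrightarrow> smooth g \<Longrightarrow> smooth (\<lambda>x. f x \<bullet> g x)"
  by (simp add: smooth_def Ck_bounded_bilinear[OF bounded_bilinear_inner])

lemma smooth_uminus: "smooth f \<Longrightarrow> smooth (\<lambda>x. - f x)"
  using smooth_scaleR[OF smooth_const[of "-1"], of f] by simp

lemma smooth_diff: "smooth f \<Longrightarrow> smooth g \<Longrightarrow> smooth (\<lambda>x. f x - g x)"
  using smooth_add[OF _ smooth_uminus, of f g] by simp

lemma smooth_divide_const: "smooth f \<Longrightarrow> smooth (\<lambda>x. f x / (c::real))"
  using smooth_mult[OF _ smooth_const[of "1/c"], of f] by simp

lemma smooth_compose_linear: "bounded_linear L \<Longrightarrow> smooth f \<Longrightarrow> smooth (\<lambda>x. f (L x))"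
  by (simp add: smooth_def Ck_compose_linear)

lemma smooth_linear_compose:
  assumes "linear L" "smooth f"
  shows "smooth (\<lambda>x. L (f x))"
proof -
  have "L (f x) = (\<Sum>b\<in>Basis. (f x \<bullet> b) *\<^sub>R L b)" for x
    using assms(1) by (subst euclidean_representation[of "f x", symmetric])
      (simp only: linear_sum linear_scale)
  then show ?thesis
    by (simp add: smooth_sum smooth_scaleR smooth_inner smooth_const assms(2))
qed

text \<open>Differentiation lowers the exponent by one, so the induction runs over all
  \<open>p\<close>. The exponent -1/2 later normalises frame vectors.\<close>

lemma smooth_powr:
  fixes f :: "'a::euclidean_space \<Rightarrow> real"
  assumes "smooth f" "\<And>x. f x > 0"
  shows "smooth (\<lambda>x. f x powr p)"
proof -
  have "Ck k (\<lambda>x. f x powr p)" for k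
  proof (induction k arbitrary: p)
    case 0
    show ?case
      using smooth_continuous[OF assms(1)] less_imp_neq[OF assms(2)]
      by (auto intro!: continuous_intros)
  next
    case (Suc k)
    show ?case
    proof (rule Ck_SucI)
      show "((\<lambda>x. f x powr p) has_derivative
          (\<lambda>v. (p * f x powr (p - 1)) * frechet_derivative f (at x) v)) (at x)" for x
        using has_derivative_compose[OF smooth_has_derivative[OF assms(1)]
            has_real_derivative_powr[OF assms(2), unfolded has_field_derivative_def]] .
      show "Ck k (\<lambda>x. p * f x powr (p - 1) * frechet_derivative f (at x) v)" for v
        using smooth_frechet_derivative[OF assms(1), of v] Suc.IH
        by (intro Ck_bounded_bilinear[OF bounded_bilinear_mult] Ck_const) (auto simp: smooth_def)
    qed
  qed
  then show ?thesis by (simp add: smooth_def)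
qed

text \<open>\<open>Ck\<close> controls derivatives in fixed directions only, so the varying
  direction \<open>X x\<close> is expanded in the standard basis.\<close>

lemma smooth_along:
  assumes "smooth X" "smooth f"
  shows "smooth (along X f)"
proof -
  have "along X f = (\<lambda>x. \<Sum>b\<in>Basis. (X x \<bullet> b) *\<^sub>R frechet_derivative f (at x) b)"
  proof
    fix x
    have "linear (frechet_derivative f (at x))"
      using smooth_has_derivative[OF assms(2)] by (rule has_derivative_linear)
    then show "along X f x = (\<Sum>b\<in>Basis. (X x \<bullet> b) *\<^sub>R frechet_derivative f (at x) b)"
      unfolding along_def by (subst euclidean_representation[of "X x", symmetric])
        (simp only: linear_sum linear_scale)
  qed
  then show ?thesis
    by (simp add: smooth_sum smooth_scaleR smooth_inner smooth_const smooth_frechet_derivative assms)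
qed

lemma along_eq:
  assumes "(f has_derivative f') (at x)"
  shows "along X f x = f' (X x)"
  using frechet_derivative_at[OF assms] by (simp add: along_def)

section \<open>Fields of bilinear forms and their flat derivative\<close>

definition form_field :: "('a::euclidean_space \<Rightarrow> 'a \<Rightarrow> 'a \<Rightarrow> real) \<Rightarrow> bool" where
  "form_field B \<longleftrightarrow> (\<forall>x. bilinear (B x)) \<and> (\<forall>v w. smooth (\<lambda>x. B x v w))"

text \<open>The arguments \<open>w\<close> and \<open>z\<close> stay constant, so this is the
  covariant derivative of \<open>B\<close> for the flat connection.\<close>

definition form_deriv :: "('a::euclidean_space \<Rightarrow> 'a \<Rightarrow> 'a \<Rightarrow> real) \<Rightarrow> 'a \<Rightarrow> 'a \<Rightarrow> 'a \<Rightarrow> 'a \<Rightarrow> real" where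
  "form_deriv B x v w z = frechet_derivative (\<lambda>y. B y w z) (at x) v"

lemma form_fieldD:
  assumes "form_field B"
  shows "bilinear (B x)" "smooth (\<lambda>x. B x v w)"
  using assms by (simp_all add: form_field_def)

lemma bilinear_expand:
  assumes "bilinear B"
  shows "B v w = (\<Sum>a\<in>Basis. \<Sum>b\<in>Basis. (v \<bullet> a) * (w \<bullet> b) * (B a b :: real))"
proof -
  have "B v w = B (\<Sum>a\<in>Basis. (v \<bullet> a) *\<^sub>R a) (\<Sum>b\<in>Basis. (w \<bullet> b) *\<^sub>R b)"
    by (simp only: euclidean_representation)
  also have "\<dots> = (\<Sum>(a,b)\<in>Basis\<times>Basis. B ((v \<bullet> a) *\<^sub>R a) ((w \<bullet> b) *\<^sub>R b))"
    by (rule bilinear_sum[OF assms])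
  also have "\<dots> = (\<Sum>a\<in>Basis. \<Sum>b\<in>Basis. (v \<bullet> a) * (w \<bullet> b) * B a b)"
    by (simp add: sum.cartesian_product bilinear_lmul[OF assms] bilinear_rmul[OF assms] ac_simps)
  finally show ?thesis .
qed

lemma form_deriv_has_derivative:
  assumes "form_field B"
  shows "((\<lambda>y. B y w z) has_derivative (\<lambda>v. form_deriv B x v w z)) (at x)"
  unfolding form_deriv_def using smooth_has_derivative[OF form_fieldD(2)[OF assms]] by simp

lemma form_deriv_unique:
  assumes "form_field B" "((\<lambda>y. B y w z) has_derivative D) (at x)"
  shows "form_deriv B x v w z = D v"
  using has_derivative_unique[OF form_deriv_has_derivative[OF assms(1)] assms(2)] by meson

lemma linear_form_deriv1:
  assumes "form_field B"
  shows "linear (\<lambda>v. form_deriv B x v w z)"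
  using form_deriv_has_derivative[OF assms] by (rule has_derivative_linear)

lemma linear_form_deriv2:
  assumes "form_field B"
  shows "linear (\<lambda>w. form_deriv B x v w z)"
proof (rule linearI)
  fix w w' c
  note d = form_deriv_has_derivative[OF assms]
  show "form_deriv B x v (w + w') z = form_deriv B x v w z + form_deriv B x v w' z"
    by (rule form_deriv_unique[OF assms], subst bilinear_ladd[OF form_fieldD(1)[OF assms]])
      (rule has_derivative_add[OF d d])
  show "form_deriv B x v (c *\<^sub>R w) z = c *\<^sub>R form_deriv B x v w z"
    by (rule form_deriv_unique[OF assms], subst bilinear_lmul[OF form_fieldD(1)[OF assms]])
      (rule has_derivative_scaleR_right[OF d])
qed

lemma linear_form_deriv3:
  assumes "form_field B"
  shows "linear (\<lambda>z. form_deriv B x v w z)"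
proof (rule linearI)
  fix z z' c
  note d = form_deriv_has_derivative[OF assms]
  show "form_deriv B x v w (z + z') = form_deriv B x v w z + form_deriv B x v w z'"
    by (rule form_deriv_unique[OF assms], subst bilinear_radd[OF form_fieldD(1)[OF assms]])
      (rule has_derivative_add[OF d d])
  show "form_deriv B x v w (c *\<^sub>R z) = c *\<^sub>R form_deriv B x v w z"
    by (rule form_deriv_unique[OF assms], subst bilinear_rmul[OF form_fieldD(1)[OF assms]])
      (rule has_derivative_scaleR_right[OF d])
qed

lemmas linear_form_deriv = linear_form_deriv1 linear_form_deriv2 linear_form_deriv3

lemma smooth_form_eval:
  assumes "form_field B" "smooth Y" "smooth Z"
  shows "smooth (\<lambda>x. B x (Y x) (Z x))"
proof -
  have "(\<lambda>x. B x (Y x) (Z x)) = (\<lambda>x. \<Sum>a\<in>Basis. \<Sum>b\<in>Basis. (Y x \<bullet> a) * (Z x \<bullet> b) * B x a b)"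
    using bilinear_expand[OF form_fieldD(1)[OF assms(1)]] by blast
  then show ?thesis
    by (simp add: smooth_sum smooth_mult smooth_inner smooth_const assms form_fieldD)
qed

lemma form_field_form_deriv:
  assumes "form_field B"
  shows "form_field (\<lambda>x w z. form_deriv B x v w z)"
  unfolding form_field_def bilinear_def
  using smooth_frechet_derivative[OF form_fieldD(2)[OF assms]]
  by (simp add: linear_form_deriv[OF assms]) (simp add: form_deriv_def)

lemma smooth_form_deriv:
  assumes "form_field B" "smooth X" "smooth Y" "smooth Z"
  shows "smooth (\<lambda>x. form_deriv B x (X x) (Y x) (Z x))"
proof -
  have "form_deriv B x (X x) (Y x) (Z x) = (\<Sum>a\<in>Basis. (X x \<bullet> a) * form_deriv B x a (Y x) (Z x))" for x
    by (subst euclidean_representation[of "X x", symmetric])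
      (simp only: linear_sum[OF linear_form_deriv1[OF assms(1)]]
        linear_scale[OF linear_form_deriv1[OF assms(1)]] real_scaleR_def)
  then show ?thesis
    by (simp add: smooth_sum smooth_mult smooth_inner smooth_const assms
        smooth_form_eval[OF form_field_form_deriv])
qed

text \<open>Writing the form in the standard basis reduces this Leibniz rule to products of real
  functions; \<open>bilinear_expand\<close> then folds the three sums back.\<close>

lemma along_form:
  assumes B: "form_field B" and Y: "smooth Y" and Z: "smooth Z"
  shows "along X (\<lambda>y. B y (Y y) (Z y)) x =
    form_deriv B x (X x) (Y x) (Z x) + B x (along X Y x) (Z x) + B x (Y x) (along X Z x)"
proof -
  have "(\<lambda>y. B y (Y y) (Z y)) = (\<lambda>y. \<Sum>a\<in>Basis. \<Sum>b\<in>Basis. (Y y \<bullet> a) * (Z y \<bullet> b) * B y a b)"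
    using bilinear_expand[OF form_fieldD(1)[OF B]] by blast
  moreover have "along X (\<lambda>y. \<Sum>a\<in>Basis. \<Sum>b\<in>Basis. (Y y \<bullet> a) * (Z y \<bullet> b) * B y a b) x =
      (\<Sum>a\<in>Basis. \<Sum>b\<in>Basis. (Y x \<bullet> a) * (Z x \<bullet> b) * form_deriv B x (X x) a b +
        ((Y x \<bullet> a) * (along X Z x \<bullet> b) + (along X Y x \<bullet> a) * (Z x \<bullet> b)) * B x a b)"
    unfolding along_def[of X Y] along_def[of X Z]
    by (rule along_eq, intro has_derivative_sum has_derivative_mult has_derivative_inner_left
        form_deriv_has_derivative[OF B] smooth_has_derivative Y Z)
  ultimately show ?thesis
    unfolding bilinear_expand[OF form_fieldD(1)[OF B], of x "along X Y x" "Z x"]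
      bilinear_expand[OF form_fieldD(1)[OF B], of x "Y x" "along X Z x"]
      bilinear_expand[OF form_fieldD(1)[OF form_field_form_deriv[OF B]], of x "X x" "Y x" "Z x"]
    by (simp add: sum.distrib algebra_simps)
qed

section \<open>The Levi-Civita connection and the Lee form\<close>

lemma riemannian_metricD:
  assumes "riemannian_metric g"
  shows "form_field g" "bilinear (g x)" "g x v w = g x w v" "v \<noteq> 0 \<Longrightarrow> 0 < g x v v"
  using assms unfolding riemannian_metric_def form_field_def by blast+

text \<open>Pairing with \<open>e j\<close> reads off the coordinates of a combination of the
  \<open>e i\<close>, so the map \<open>L\<close> is injective, hence surjective by equality of
  dimensions.\<close>

lemma orthonormal_expansion:
  fixes B :: "'a::euclidean_space \<Rightarrow> 'a \<Rightarrow> real" and e :: "'a \<Rightarrow> 'a"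
  assumes B: "bilinear B"
    and e: "\<And>i j. i \<in> Basis \<Longrightarrow> j \<in> Basis \<Longrightarrow> B (e i) (e j) = (if i = j then 1 else 0)"
  shows "(\<Sum>i\<in>Basis. B v (e i) *\<^sub>R e i) = v"
proof -
  define L where "L u = (\<Sum>i\<in>Basis. (u \<bullet> i) *\<^sub>R e i)" for u :: 'a
  have lin: "linear L"
    unfolding L_def by (intro linearI)
      (simp_all add: inner_left_distrib scaleR_left_distrib sum.distrib scaleR_sum_right)
  have coord: "B (L u) (e j) = u \<bullet> j" if "j \<in> Basis" for u j
  proof -
    have l: "linear (\<lambda>w. B w (e j))"
      using B by (simp add: bilinear_def)
    have "B (L u) (e j) = (\<Sum>i\<in>Basis. (u \<bullet> i) * B (e i) (e j))"
      unfolding L_def by (simp add: linear_sum[OF l] linear_scale[OF l])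
    also have "\<dots> = (\<Sum>i\<in>Basis. if i = j then u \<bullet> i else 0)"
      using that by (intro sum.cong) (auto simp: e)
    finally show ?thesis
      using that by simp
  qed
  have "inj L"
    unfolding linear_injective_0[OF lin]
  proof (intro allI impI)
    fix u assume "L u = 0"
    then have "u \<bullet> j = 0" if "j \<in> Basis" for j
      using coord[OF that, of u] bilinear_lzero[OF B] by simp
    then show "u = 0"
      by (rule euclidean_all_zero_iff[THEN iffD1, OF ballI])
  qed
  then obtain u where "v = L u"
    using linear_injective_imp_surjective[OF lin] by (metis surjD)
  then show ?thesis
    using coord[of _ u] by (simp add: L_def)
qed

text \<open>The change of basis between \<open>e\<close> and \<open>f\<close> is an orthogonal
  matrix. This frees the codifferential from the frame chosen in its definition.\<close>

lemma trace_orthonormal: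
  fixes B T :: "'a::euclidean_space \<Rightarrow> 'a \<Rightarrow> real" and e f :: "'a \<Rightarrow> 'a"
  assumes B: "bilinear B" and sym: "\<And>v w. B v w = B w v"
    and e: "\<And>i j. i \<in> Basis \<Longrightarrow> j \<in> Basis \<Longrightarrow> B (e i) (e j) = (if i = j then 1 else 0)"
    and f: "\<And>i j. i \<in> Basis \<Longrightarrow> j \<in> Basis \<Longrightarrow> B (f i) (f j) = (if i = j then 1 else 0)"
    and T: "bilinear T"
  shows "(\<Sum>i\<in>Basis. T (e i) (e i)) = (\<Sum>i\<in>Basis. T (f i) (f i))"
proof -
  have 1: "T (f j) (f j) = (\<Sum>i\<in>Basis. \<Sum>k\<in>Basis. B (f j) (e i) * B (f j) (e k) * T (e i) (e k))" for j
  proof -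
    have "T (f j) (f j) = T (\<Sum>i\<in>Basis. B (f j) (e i) *\<^sub>R e i) (\<Sum>i\<in>Basis. B (f j) (e i) *\<^sub>R e i)"
      by (simp only: orthonormal_expansion[OF B e])
    then show ?thesis
      by (simp add: bilinear_sum[OF T] sum.cartesian_product bilinear_lmul[OF T] bilinear_rmul[OF T] ac_simps)
  qed
  \<comment> \<open>Orthogonality of the transition matrix \<open>B (f j) (e i)\<close>, read off
    from the expansion of \<open>e i\<close> in the basis \<open>f\<close>.\<close>
  have 2: "(\<Sum>j\<in>Basis. B (f j) (e i) * B (f j) (e k)) = B (e i) (e k)" for i k
  proof -
    have "B (e i) (e k) = B (\<Sum>j\<in>Basis. B (e i) (f j) *\<^sub>R f j) (e k)"
      by (simp only: orthonormal_expansion[OF B f])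
    also have "\<dots> = (\<Sum>j\<in>Basis. B (e i) (f j) * B (f j) (e k))"
      using B by (simp add: bilinear_def linear_sum[of "\<lambda>w. B w (e k)"] linear_scale[of "\<lambda>w. B w (e k)"])
    finally show ?thesis
      by (simp add: sym[of "e i"])
  qed
  have "(\<Sum>j\<in>Basis. T (f j) (f j)) =
      (\<Sum>j\<in>Basis. \<Sum>i\<in>Basis. \<Sum>k\<in>Basis. B (f j) (e i) * B (f j) (e k) * T (e i) (e k))"
    by (simp only: 1)
  also have "\<dots> = (\<Sum>i\<in>Basis. \<Sum>j\<in>Basis. \<Sum>k\<in>Basis. B (f j) (e i) * B (f j) (e k) * T (e i) (e k))"
    by (rule sum.swap)
  also have "\<dots> = (\<Sum>i\<in>Basis. \<Sum>k\<in>Basis. \<Sum>j\<in>Basis. B (f j) (e i) * B (f j) (e k) * T (e i) (e k))"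
    by (intro sum.cong refl sum.swap)
  also have "\<dots> = (\<Sum>i\<in>Basis. \<Sum>k\<in>Basis. B (e i) (e k) * T (e i) (e k))"
    by (simp only: sum_distrib_right[symmetric] 2)
  also have "\<dots> = (\<Sum>i\<in>Basis. \<Sum>k\<in>Basis. if i = k then T (e i) (e k) else 0)"
    by (intro sum.cong refl) (simp add: e)
  also have "\<dots> = (\<Sum>i\<in>Basis. T (e i) (e i))"
    by simp
  finally show ?thesis by simp
qed

section \<open>The Koszul formula and the Christoffel terms\<close>

definition koszul :: "('a::euclidean_space \<Rightarrow> 'a \<Rightarrow> 'a \<Rightarrow> real) \<Rightarrow> 'a \<Rightarrow> 'a \<Rightarrow> 'a \<Rightarrow> 'a \<Rightarrow> real" where
  "koszul g x v w z = (form_deriv g x v w z + form_deriv g x w v z - form_deriv g x z v w) / 2"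

text \<open>\<open>koszul\<close> gives the Levi-Civita derivative of constant fields, whose
  brackets vanish, paired with \<open>z\<close>. Its index is raised here by an orthonormal frame in
  place of an inverse matrix, so smoothness is inherited from the frame.\<close>

definition christoffel ::
    "('a::euclidean_space \<Rightarrow> 'a \<Rightarrow> 'a \<Rightarrow> real) \<Rightarrow> ('a \<Rightarrow> 'a \<Rightarrow> 'a) \<Rightarrow> 'a \<Rightarrow> 'a \<Rightarrow> 'a \<Rightarrow> 'a" where
  "christoffel g E x v w = (\<Sum>i\<in>Basis. koszul g x v w (E i x) *\<^sub>R E i x)"

lemma form_deriv_sym:
  assumes "riemannian_metric g"
  shows "form_deriv g x v w z = form_deriv g x v z w"
  unfolding form_deriv_def by (simp only: riemannian_metricD(3)[OF assms, of _ w z])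

lemma linear_koszul:
  assumes "form_field g"
  shows "linear (\<lambda>v. koszul g x v w z)" "linear (\<lambda>w. koszul g x v w z)" "linear (\<lambda>z. koszul g x v w z)"
  unfolding koszul_def
  by (auto intro!: linearI simp: linear_add[OF linear_form_deriv1[OF assms]]
      linear_add[OF linear_form_deriv2[OF assms]] linear_add[OF linear_form_deriv3[OF assms]]
      linear_scale[OF linear_form_deriv1[OF assms]] linear_scale[OF linear_form_deriv2[OF assms]]
      linear_scale[OF linear_form_deriv3[OF assms]] field_simps)

lemma linear_christoffel:
  assumes "form_field g"
  shows "linear (\<lambda>v. christoffel g E x v w)" "linear (\<lambda>w. christoffel g E x v w)"
  unfolding christoffel_def
  by (auto intro!: linearI simp: linear_add[OF linear_koszul(1)[OF assms]]
      linear_add[OF linear_koszul(2)[OF assms]] linear_scale[OF linear_koszul(1)[OF assms]]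
      linear_scale[OF linear_koszul(2)[OF assms]] sum.distrib scaleR_left_distrib scaleR_sum_right)

lemma christoffel_sym:
  assumes "riemannian_metric g"
  shows "christoffel g E x v w = christoffel g E x w v"
  unfolding christoffel_def koszul_def
  by (simp add: form_deriv_sym[OF assms, of _ _ v w] add.commute)

text \<open>Expanding \<open>z\<close> in the frame shows that lowering the index with
  \<open>g\<close> undoes the raising in \<open>christoffel\<close>.\<close>

lemma metric_christoffel:
  assumes g: "riemannian_metric g" and E: "orthonormal_frame g E"
  shows "g x (christoffel g E x v w) z = koszul g x v w z"
proof -
  note B = riemannian_metricD(2)[OF g]
  have l: "linear (\<lambda>u. g x u z)"
    using B by (simp add: bilinear_def)
  have "koszul g x v w z = koszul g x v w (\<Sum>i\<in>Basis. g x z (E i x) *\<^sub>R E i x)"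
    using orthonormal_expansion[OF B, where e = "\<lambda>i. E i x"] E by (simp add: orthonormal_frame_def)
  also have "\<dots> = (\<Sum>i\<in>Basis. g x z (E i x) * koszul g x v w (E i x))"
    by (simp add: linear_sum[OF linear_koszul(3)] linear_scale[OF linear_koszul(3)]
        riemannian_metricD(1)[OF g])
  finally show ?thesis
    unfolding christoffel_def
    by (simp add: linear_sum[OF l] linear_scale[OF l] riemannian_metricD(3)[OF g, of x z] mult.commute)
qed

definition frame_connection ::
    "('a::euclidean_space \<Rightarrow> 'a \<Rightarrow> 'a \<Rightarrow> real) \<Rightarrow> ('a \<Rightarrow> 'a \<Rightarrow> 'a) \<Rightarrow> 'a connection" where
  "frame_connection g E X Y x = along X Y x + christoffel g E x (X x) (Y x)"

lemma smooth_christoffel: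
  assumes "form_field g" "orthonormal_frame g E" "smooth X" "smooth Y"
  shows "smooth (\<lambda>x. christoffel g E x (X x) (Y x))"
  using assms unfolding christoffel_def koszul_def orthonormal_frame_def
  by (intro smooth_sum smooth_scaleR smooth_divide_const smooth_diff smooth_add smooth_form_deriv) auto

lemma along_add_field:
  assumes "smooth f"
  shows "along (\<lambda>x. X x + X' x) f x = along X f x + along X' f x"
    "along (\<lambda>x. \<phi> x *\<^sub>R X x) f x = \<phi> x *\<^sub>R along X f x"
  using has_derivative_linear[OF smooth_has_derivative[OF assms, of x]]
  by (simp_all add: along_def linear_add linear_scale)

lemma along_add:
  assumes "smooth f" "smooth h"
  shows "along X (\<lambda>x. f x + h x) x = along X f x + along X h x"
  unfolding along_def[of X f] along_def[of X h]
  by (rule along_eq, rule has_derivative_add[OF smooth_has_derivative smooth_has_derivative]) fact+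

lemma along_scaleR:
  assumes "smooth \<phi>" "smooth f"
  shows "along X (\<lambda>x. \<phi> x *\<^sub>R f x) x = \<phi> x *\<^sub>R along X f x + along X \<phi> x *\<^sub>R f x"
  unfolding along_def[of X f] along_def[of X \<phi>]
  by (rule along_eq, rule has_derivative_scaleR[OF smooth_has_derivative smooth_has_derivative]) fact+

lemma affine_frame_connection:
  assumes g: "form_field g" and E: "orthonormal_frame g E"
  shows "affine_connection (frame_connection g E)"
  unfolding affine_connection_def frame_connection_def
  using linear_christoffel[OF g, THEN linear_add] linear_christoffel[OF g, THEN linear_scale]
  by (auto simp: along_add_field along_add along_scaleR smooth_christoffel[OF g E] smooth_along
      smooth_add fun_eq_iff algebra_simps)

lemma torsion_free_frame_connection:
  assumes "riemannian_metric g"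
  shows "torsion_free (frame_connection g E)"
  unfolding torsion_free_def frame_connection_def lie_bracket_def
  using christoffel_sym[OF assms] by (metis add_diff_cancel_right)

lemma metric_frame_connection:
  assumes g: "riemannian_metric g" and E: "orthonormal_frame g E"
  shows "metric_connection g (frame_connection g E)"
  unfolding metric_connection_def frame_connection_def
proof (intro allI impI)
  fix X Y Z :: "'a \<Rightarrow> 'a" and x
  assume "smooth X" "smooth Y" "smooth Z"
  note B = riemannian_metricD(2)[OF g] and s = riemannian_metricD(3)[OF g]
  \<comment> \<open>In the sum of the two Koszul expressions everything cancels except the two
    halves of the derivative along \<open>X\<close>.\<close>
  have "g x (christoffel g E x (X x) (Y x)) (Z x) + g x (Y x) (christoffel g E x (X x) (Z x)) =
      form_deriv g x (X x) (Y x) (Z x)"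
    unfolding s[of x "Y x"] metric_christoffel[OF g E] koszul_def
    by (simp add: form_deriv_sym[OF g, of x _ "Z x"] form_deriv_sym[OF g, of x _ "Y x" "X x"] field_simps)
  then show "along X (\<lambda>y. g y (Y y) (Z y)) x =
      g x (along X Y x + christoffel g E x (X x) (Y x)) (Z x) +
      g x (Y x) (along X Z x + christoffel g E x (X x) (Z x))"
    by (simp add: along_form[OF riemannian_metricD(1)[OF g] \<open>smooth Y\<close> \<open>smooth Z\<close>]
        bilinear_ladd[OF B] bilinear_radd[OF B])
qed

text \<open>The difference of the two connections, lowered with \<open>g\<close>, is symmetric in its first two and
  skew in its last two arguments, hence zero.\<close>

lemma metric_torsion_free_unique:
  assumes g: "riemannian_metric g"
    and D: "torsion_free D" "metric_connection g D"
    and D': "torsion_free D'" "metric_connection g D'"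
    and X: "smooth X" and Y: "smooth Y"
  shows "D X Y x = D' X Y x"
proof -
  note B = riemannian_metricD(2)[OF g] and s = riemannian_metricD(3)[OF g]
  define A where "A X Y = D X Y x - D' X Y x" for X Y
  have sym: "A X Y = A Y X" if "smooth X" "smooth Y" for X Y
  proof -
    have "D X Y x - D Y X x = D' X Y x - D' Y X x"
      using D(1) D'(1) that by (simp add: torsion_free_def)
    then show ?thesis
      by (simp add: A_def algebra_simps)
  qed
  have skew: "g x (A X Y) (Z x) = - g x (A X Z) (Y x)" if "smooth X" "smooth Y" "smooth Z" for X Y Z
  proof -
    have "g x (D X Y x) (Z x) + g x (Y x) (D X Z x) = g x (D' X Y x) (Z x) + g x (Y x) (D' X Z x)"
      using D(2)[unfolded metric_connection_def, rule_format, OF that, of x]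
        D'(2)[unfolded metric_connection_def, rule_format, OF that, of x] by simp
    then show ?thesis
      unfolding A_def by (simp add: bilinear_lsub[OF B] s[of x "Y x"])
  qed
  have zero: "g x (A X Y) (Z x) = 0" if "smooth Z" for Z
    using skew[OF X Y that] skew[OF that X Y] skew[OF Y that X]
      sym[OF X Y] sym[OF X that] sym[OF Y that] by simp
  have "A X Y = 0"
    using zero[OF smooth_const[of "A X Y"]] riemannian_metricD(4)[OF g, of "A X Y" x] by force
  then show ?thesis by (simp add: A_def)
qed

text \<open>The frame connection witnesses existence, so the choice in \<open>levi_civita\<close>
  does yield a torsion-free metric connection; uniqueness on smooth fields then transfers the
  explicit formula.\<close>

lemma levi_civita_eq:
  assumes g: "riemannian_metric g" and E: "orthonormal_frame g E"
    and "smooth X" "smooth Y"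
  shows "levi_civita g X Y x = along X Y x + christoffel g E x (X x) (Y x)"
proof -
  have F: "affine_connection (frame_connection g E) \<and> torsion_free (frame_connection g E) \<and>
      metric_connection g (frame_connection g E)"
    using affine_frame_connection[OF riemannian_metricD(1)[OF g] E]
      torsion_free_frame_connection[OF g] metric_frame_connection[OF g E] by simp
  then have "affine_connection (levi_civita g) \<and> torsion_free (levi_civita g) \<and>
      metric_connection g (levi_civita g)"
    unfolding levi_civita_def
    by (rule someI[where P = "\<lambda>D. affine_connection D \<and> torsion_free D \<and> metric_connection g D"])
  then have "levi_civita g X Y x = frame_connection g E X Y x"
    using F metric_torsion_free_unique[OF g _ _ _ _ assms(3,4)] by blast
  then show ?thesis by (simp add: frame_connection_def)
qed

text \<open>Since \<open>J\<close> is constant, its identities with \<open>g\<close> can be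
  differentiated, which moves \<open>J\<close> across the slots of \<open>form_deriv g\<close>. Each
  summand of the codifferential then involves only \<open>F i x\<close>, \<open>J (F i x)\<close>
  and \<open>Z x\<close>, and frame independence of traces does the rest.\<close>

lemma lee_form_flat_complex_structure:
  fixes g :: "'a::euclidean_space \<Rightarrow> 'a \<Rightarrow> 'a \<Rightarrow> real"
  assumes g: "riemannian_metric g" and E: "orthonormal_frame g E"
    and J: "linear J" "\<And>v. J (J v) = - v" and gJ: "\<And>x v w. g x (J v) (J w) = g x v w"
    and Z: "smooth Z"
  shows "lee_form (\<lambda>_. J) g Z x =
    (\<Sum>i\<in>Basis. form_deriv g x (Z x) (E i x) (E i x)) / 2 -
    (\<Sum>i\<in>Basis. form_deriv g x (E i x) (E i x) (Z x))"
proof -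
  \<comment> \<open>The frame that \<open>codifferential\<close> selects by choice; \<open>E\<close>
    shows that there is one.\<close>
  define F where "F = (SOME E. orthonormal_frame g E)"
  have F: "orthonormal_frame g F"
    unfolding F_def by (rule someI[of "orthonormal_frame g", OF E])
  note ff = riemannian_metricD(1)[OF g] and B = riemannian_metricD(2)[OF g]
    and s = riemannian_metricD(3)[OF g]
  let ?\<omega> = "fundamental_form (\<lambda>_. J) g"
  let ?D = "form_deriv g x"
  have w: "form_field ?\<omega>"
    unfolding form_field_def fundamental_form_def
    using B ff linear_compose[OF J(1), of "\<lambda>u. g _ u _"]
    by (auto simp: bilinear_def form_field_def o_def)
  have JZ: "smooth (\<lambda>y. J (Z y))"
    by (rule smooth_linear_compose[OF J(1) Z])
  have gJ': "g y v (J w) = - g y (J v) w" for y v w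
    using gJ[of y v "J w"] by (simp add: J(2) bilinear_rneg[OF B])
  \<comment> \<open>\<open>D1\<close> to \<open>D3\<close> come from differentiating invariance of
    \<open>g\<close> under \<open>J\<close>, \<open>g y a (J a) = 0\<close> and skewness of
    \<open>J\<close>, with \<open>J\<close> constant in the base point.\<close>
  have D1: "?D v (J a) (J b) = ?D v a b" for v a b
    unfolding form_deriv_def by (simp add: gJ)
  have D2: "?D v a (J a) = 0" for v a
  proof -
    have "g y a (J a) = 0" for y
      using gJ'[of y a a] s[of y a "J a"] by simp
    then show ?thesis
      by (simp add: form_deriv_def)
  qed
  have D3: "?D v a (J b) = - ?D v (J a) b" for v a b
    by (rule form_deriv_unique[OF ff])
      (simp add: gJ' has_derivative_minus[OF form_deriv_has_derivative[OF ff]])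
  have cov: "cov_deriv2 (levi_civita g) ?\<omega> (F i) (F i) (\<lambda>y. J (Z y)) x =
      (?D (Z x) (F i x) (F i x) - ?D (F i x) (F i x) (Z x) - ?D (J (F i x)) (J (F i x)) (Z x)) / 2"
    if "i \<in> Basis" for i
  proof -
    have Fi: "smooth (F i)"
      using F that by (simp add: orthonormal_frame_def)
    define X where "X = F i x"
    define z where "z = Z x"
    have "cov_deriv2 (levi_civita g) ?\<omega> (F i) (F i) (\<lambda>y. J (Z y)) x =
        form_deriv ?\<omega> x X X (J z) - ?\<omega> x (christoffel g F x X X) (J z) -
        ?\<omega> x X (christoffel g F x X (J z))"
      unfolding cov_deriv2_def along_form[OF w Fi JZ] levi_civita_eq[OF g F Fi Fi]
        levi_civita_eq[OF g F Fi JZ] X_def z_def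
      by (simp add: bilinear_ladd[OF form_fieldD(1)[OF w]] bilinear_radd[OF form_fieldD(1)[OF w]])
    \<comment> \<open>Every value of \<omega> is rewritten through \<open>g\<close>, with
      \<open>J\<close> cancelled against \<open>J z\<close> or left on \<open>X\<close>;
      \<open>metric_christoffel\<close> then turns the Christoffel terms into Koszul
      expressions.\<close>
    also have "\<dots> = ?D X X z - koszul g x X X z - koszul g x X (J z) (J X)"
      using D1[of X X z] metric_christoffel[OF g F]
      by (simp add: fundamental_form_def gJ s[of x "J X"] form_deriv_def)
    also have "\<dots> = (?D z X X - ?D X X z - ?D (J X) (J X) z) / 2"
      unfolding koszul_def D1 D2 D3[of "J X" X z] form_deriv_sym[OF g, of x X z X]
      by (simp add: field_simps)
    finally show ?thesis by (simp add: X_def z_def)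
  qed
  have lee: "lee_form (\<lambda>_. J) g Z x = (\<Sum>i\<in>Basis.
      (?D (Z x) (F i x) (F i x) - ?D (F i x) (F i x) (Z x) - ?D (J (F i x)) (J (F i x)) (Z x)) / 2)"
    unfolding lee_form_def codifferential_def Let_def F_def[symmetric] by (simp add: cov)
  have tr: "(\<Sum>i\<in>Basis. T (F' i) (F' i)) = (\<Sum>i\<in>Basis. T (E i x) (E i x))"
    if "bilinear T" "\<And>i j. i \<in> Basis \<Longrightarrow> j \<in> Basis \<Longrightarrow> g x (F' i) (F' j) = (if i = j then 1 else 0)"
    for T :: "'a \<Rightarrow> 'a \<Rightarrow> real" and F' :: "'a \<Rightarrow> 'a"
    by (rule trace_orthonormal[OF B s that(2) _ that(1)]) (use E in \<open>auto simp: orthonormal_frame_def\<close>)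
  have oF: "g x (F i x) (F j x) = (if i = j then 1 else 0)" if "i \<in> Basis" "j \<in> Basis" for i j
    using F that by (simp add: orthonormal_frame_def)
  have T1: "bilinear (\<lambda>a b. ?D (Z x) a b)" and T2: "bilinear (\<lambda>a b. ?D a b (Z x))"
    by (simp_all add: bilinear_def linear_form_deriv[OF ff])
  \<comment> \<open>The vectors \<open>J (F i x)\<close> are again orthonormal, so the last two sums
    have equal traces and their halves add up to a full one, while the first keeps its factor
    1/2.\<close>
  show ?thesis
    unfolding lee sum_divide_distrib[symmetric] sum_subtractf
    using tr[OF T1 oF] tr[OF T2 oF] tr[OF T2, of "\<lambda>i. J (F i x)"] oF by (simp add: gJ field_simps)
qed

section \<open>The canonical Hermitian structure\<close>

lemma g1_canonical:
  "g1 canonical_connection m p v w = m (fst p) (fst v) (fst w) + m (fst p) (snd v) (snd w)"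
  by (simp add: g1_def vpart_def canonical_connection_def along_def)

text \<open>The canonical connection annihilates constant fields, so \<open>J1\<close> is the same
  at every point, as the Lee form computation requires.\<close>

lemma J1_canonical: "J1 canonical_connection = (\<lambda>_ w. (- snd w, fst w))"
  by (simp add: fun_eq_iff J1_def vpart_def canonical_connection_def along_def hlift_def vlift_def)

lemma riemannian_g1_canonical:
  assumes m: "riemannian_metric m"
  shows "riemannian_metric (g1 canonical_connection m)"
proof -
  note B = riemannian_metricD(2)[OF m]
  have "bilinear (g1 canonical_connection m p)" for p
    unfolding bilinear_def g1_canonical
    by (auto intro!: linearI simp: bilinear_ladd[OF B] bilinear_radd[OF B] bilinear_lmul[OF B]
        bilinear_rmul[OF B] algebra_simps)
  moreover have "0 < g1 canonical_connection m p v v" if "v \<noteq> 0" for p v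
  proof -
    have nn: "0 \<le> m (fst p) u u" for u
      using riemannian_metricD(4)[OF m, of u "fst p"] bilinear_lzero[OF B] by (cases "u = 0") auto
    have "fst v \<noteq> 0 \<or> snd v \<noteq> 0"
      using that by (simp add: prod_eq_iff)
    then show ?thesis
      using riemannian_metricD(4)[OF m] nn[of "fst v"] nn[of "snd v"]
      unfolding g1_canonical by (metis add_pos_nonneg add_nonneg_pos)
  qed
  moreover have "smooth (\<lambda>p. g1 canonical_connection m p v w)" for v w
    unfolding g1_canonical
    by (intro smooth_add smooth_compose_linear[OF bounded_linear_fst, of "\<lambda>x. m x _ _"]
        form_fieldD(2)[OF riemannian_metricD(1)[OF m]])
  ultimately show ?thesis
    unfolding riemannian_metric_def using riemannian_metricD(3)[OF m]
    by (simp add: g1_canonical)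
qed

text \<open>A basis vector of a product has exactly one nonzero component, so
  \<open>snd i = 0\<close> picks the indices of the horizontal lifts and the others carry vertical
  lifts.\<close>

definition lift_frame :: "('a::euclidean_space \<Rightarrow> 'a \<Rightarrow> 'a) \<Rightarrow> 'a \<times> 'a \<Rightarrow> 'a \<times> 'a \<Rightarrow> 'a \<times> 'a" where
  "lift_frame e i p = (if snd i = 0 then (e (fst i) (fst p), 0) else (0, e (snd i) (fst p)))"

lemma orthonormal_lift_frame:
  assumes m: "riemannian_metric m" and e: "orthonormal_frame m e"
  shows "orthonormal_frame (g1 canonical_connection m) (lift_frame e)"
proof -
  note B = riemannian_metricD(2)[OF m]
  have l: "linear (\<lambda>u::'a. (u, 0::'a))" "linear (\<lambda>u::'a. (0::'a, u))"
    by (auto intro!: linearI)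
  have "smooth (\<lambda>p::'a \<times> 'a. e i (fst p))" if "i \<in> Basis" for i
    using smooth_compose_linear[OF bounded_linear_fst] e that by (auto simp: orthonormal_frame_def)
  then have "smooth (\<lambda>p::'a \<times> 'a. (e i (fst p), 0::'a))" "smooth (\<lambda>p::'a \<times> 'a. (0::'a, e i (fst p)))"
    if "i \<in> Basis" for i
    using that smooth_linear_compose[OF l(1)] smooth_linear_compose[OF l(2)] by blast+
  then show ?thesis
    using e unfolding orthonormal_frame_def lift_frame_def Basis_prod_def
    by (auto simp: g1_canonical bilinear_lzero[OF B] bilinear_rzero[OF B] nonzero_Basis)
qed

lemma form_deriv_g1_canonical:
  assumes m: "riemannian_metric m"
  shows "form_deriv (g1 canonical_connection m) p v w z =
    form_deriv m (fst p) (fst v) (fst w) (fst z) + form_deriv m (fst p) (fst v) (snd w) (snd z)"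
proof (rule form_deriv_unique[OF riemannian_metricD(1)[OF riemannian_g1_canonical[OF m]]])
  have "((\<lambda>p. m (fst p) a b) has_derivative (\<lambda>v. form_deriv m (fst p) (fst v) a b)) (at p)" for a b
    using has_derivative_compose[OF bounded_linear_imp_has_derivative[OF bounded_linear_fst]
        form_deriv_has_derivative[OF riemannian_metricD(1)[OF m]]] .
  from has_derivative_add[OF this this]
  show "((\<lambda>p. g1 canonical_connection m p w z) has_derivative
      (\<lambda>v. form_deriv m (fst p) (fst v) (fst w) (fst z) + form_deriv m (fst p) (fst v) (snd w) (snd z)))
      (at p)"
    unfolding g1_canonical .
qed

lemma sum_Basis_prod:
  fixes f :: "'a::euclidean_space \<times> 'b::euclidean_space \<Rightarrow> real"
  shows "sum f Basis = (\<Sum>i\<in>Basis. f (i, 0)) + (\<Sum>i\<in>Basis. f (0, i))"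
proof -
  have "inj_on (\<lambda>u. (u::'a, 0::'b)) Basis" "inj_on (\<lambda>u. (0::'a, u::'b)) Basis"
    by (auto intro: inj_onI)
  then show ?thesis
    unfolding Basis_prod_def
    by (subst sum.union_disjoint) (auto simp: sum.reindex nonzero_Basis)
qed

text \<open>Horizontal and vertical frame vectors contribute equally to the first trace, which
  absorbs the factor 1/2. To the second only the horizontal ones contribute, because
  \<open>g1\<close> does not vary along the fibres.\<close>

lemma lee_form_canonical:
  assumes m: "riemannian_metric m" and e: "orthonormal_frame m e" and Z: "smooth Z"
  shows "lee_form (J1 canonical_connection) (g1 canonical_connection m) Z p =
    (\<Sum>i\<in>Basis. form_deriv m (fst p) (fst (Z p)) (e i (fst p)) (e i (fst p)) -
      form_deriv m (fst p) (e i (fst p)) (e i (fst p)) (fst (Z p)))"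
proof -
  note ff = riemannian_metricD(1)[OF m] and B = riemannian_metricD(2)[OF m]
  have J: "linear (\<lambda>w::'a\<times>'a. (- snd w, fst w))"
    by (auto intro!: linearI)
  have gJ: "g1 canonical_connection m x (- snd v, fst v) (- snd w, fst w) =
      g1 canonical_connection m x v w" for x v w
    by (simp add: g1_canonical bilinear_lneg[OF B] bilinear_rneg[OF B])
  have 0: "form_deriv m x 0 w z = 0" "form_deriv m x v 0 z = 0" "form_deriv m x v w 0 = 0" for x v w z
    using linear_form_deriv[OF ff, THEN linear_0] by auto
  have "lee_form (J1 canonical_connection) (g1 canonical_connection m) Z p =
    (\<Sum>i\<in>Basis. form_deriv (g1 canonical_connection m) p (Z p) (lift_frame e i p) (lift_frame e i p)) / 2 -
    (\<Sum>i\<in>Basis. form_deriv (g1 canonical_connection m) p (lift_frame e i p) (lift_frame e i p) (Z p))"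
    unfolding J1_canonical
    by (rule lee_form_flat_complex_structure[OF riemannian_g1_canonical[OF m] orthonormal_lift_frame[OF m e],
          where J = "\<lambda>w. (- snd w, fst w)", OF J _ gJ Z])
      (simp add: prod_eq_iff)
  also have "\<dots> = (\<Sum>i\<in>Basis. form_deriv m (fst p) (fst (Z p)) (e i (fst p)) (e i (fst p)) -
      form_deriv m (fst p) (e i (fst p)) (e i (fst p)) (fst (Z p)))"
    unfolding sum_Basis_prod form_deriv_g1_canonical[OF m] lift_frame_def
    by (simp add: 0 sum_subtractf nonzero_Basis cong: sum.cong)
  finally show ?thesis .
qed

section \<open>Metrics on the plane\<close>

lemma metric_of_eq:
  "metric_of \<mu>11 \<mu>12 \<mu>22 x v w =
    \<mu>11 x * (v$1 * w$1) + \<mu>12 x * (v$1 * w$2 + v$2 * w$1) + \<mu>22 x * (v$2 * w$2)"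
  by (simp add: metric_of_def inner_vec_def sum_2 matrix_vector_mult_def algebra_simps)

lemma smooth_metric_coefficients:
  assumes "riemannian_metric (metric_of \<mu>11 \<mu>12 \<mu>22)"
  shows "smooth \<mu>11" "smooth \<mu>12" "smooth \<mu>22"
proof -
  note s = form_fieldD(2)[OF riemannian_metricD(1)[OF assms]]
  show "smooth \<mu>11" "smooth \<mu>12" "smooth \<mu>22"
    using s[of "axis 1 1" "axis 1 1"] s[of "axis 1 1" "axis 2 1"] s[of "axis 2 1" "axis 2 1"]
    by (simp_all add: metric_of_eq axis_def)
qed

lemma frechet_derivative_partial:
  fixes f :: "real^2 \<Rightarrow> real"
  assumes "smooth f"
  shows "frechet_derivative f (at x) v = v$1 * partial 1 f x + v$2 * partial 2 f x"
proof -
  have l: "linear (frechet_derivative f (at x))"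
    using smooth_has_derivative[OF assms] by (rule has_derivative_linear)
  have "v = v$1 *\<^sub>R axis 1 1 + v$2 *\<^sub>R axis 2 1"
    by (simp add: vec_eq_iff forall_2 axis_def)
  then have "frechet_derivative f (at x) v = frechet_derivative f (at x) (v$1 *\<^sub>R axis 1 1 + v$2 *\<^sub>R axis 2 1)"
    by simp
  then show ?thesis
    by (simp add: linear_add[OF l] linear_scale[OF l] partial_def)
qed

lemma form_deriv_metric_of:
  assumes "riemannian_metric (metric_of \<mu>11 \<mu>12 \<mu>22)"
  shows "form_deriv (metric_of \<mu>11 \<mu>12 \<mu>22) x v w z =
    (v$1 * partial 1 \<mu>11 x + v$2 * partial 2 \<mu>11 x) * (w$1 * z$1) +
    (v$1 * partial 1 \<mu>12 x + v$2 * partial 2 \<mu>12 x) * (w$1 * z$2 + w$2 * z$1) +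
    (v$1 * partial 1 \<mu>22 x + v$2 * partial 2 \<mu>22 x) * (w$2 * z$2)"
proof (rule form_deriv_unique[OF riemannian_metricD(1)[OF assms]])
  note s = smooth_metric_coefficients[OF assms]
  have d: "((\<lambda>y. f y * c) has_derivative (\<lambda>v. (v$1 * partial 1 f x + v$2 * partial 2 f x) * c)) (at x)"
    if "smooth f" for f and c :: real
    using has_derivative_mult_left[OF smooth_has_derivative[OF that, of x], of c]
    unfolding frechet_derivative_partial[OF that] .
  show "((\<lambda>y. metric_of \<mu>11 \<mu>12 \<mu>22 y w z) has_derivative
      (\<lambda>v. (v$1 * partial 1 \<mu>11 x + v$2 * partial 2 \<mu>11 x) * (w$1 * z$1) +
        (v$1 * partial 1 \<mu>12 x + v$2 * partial 2 \<mu>12 x) * (w$1 * z$2 + w$2 * z$1) +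
        (v$1 * partial 1 \<mu>22 x + v$2 * partial 2 \<mu>22 x) * (w$2 * z$2))) (at x)"
    unfolding metric_of_eq by (intro has_derivative_add d s)
qed

lemma Basis_vec2: "(Basis :: (real^2) set) = {axis 1 1, axis 2 1}"
  by (auto simp: Basis_vec_def UNIV_2)

lemma axis_2_neq_axis_1: "axis 2 (1::real) \<noteq> (axis 1 1 :: real^2)"
  by (simp add: axis_eq_axis)

lemma axis_nth_2:
  "(axis 1 1 :: real^2) $ 1 = 1" "(axis 1 1 :: real^2) $ 2 = 0"
  "(axis 2 1 :: real^2) $ 1 = 0" "(axis 2 1 :: real^2) $ 2 = 1"
  by (simp_all add: axis_def)

definition triangular_frame ::
    "(real^2 \<Rightarrow> real) \<Rightarrow> (real^2 \<Rightarrow> real) \<Rightarrow> (real^2 \<Rightarrow> real) \<Rightarrow> real^2 \<Rightarrow> real^2 \<Rightarrow> real^2" where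
  "triangular_frame \<alpha> \<beta> \<gamma> i x =
    (if i = axis 1 1 then \<alpha> x *\<^sub>R axis 1 1 else \<beta> x *\<^sub>R axis 1 1 + \<gamma> x *\<^sub>R axis 2 1)"

text \<open>Gram-Schmidt on the coordinate fields. Up to scaling the second vector is
  \<open>(- \<mu>12, \<mu>11)\<close>, which is orthogonal to \<open>axis 1 1\<close>.\<close>

lemma triangular_orthonormal_frame_exists:
  fixes \<mu>11 \<mu>12 \<mu>22 :: "real^2 \<Rightarrow> real"
  assumes m: "riemannian_metric (metric_of \<mu>11 \<mu>12 \<mu>22)"
  shows "\<exists>\<alpha> \<beta> \<gamma>. (\<forall>x. \<alpha> x > 0 \<and> \<gamma> x > 0) \<and>
    orthonormal_frame (metric_of \<mu>11 \<mu>12 \<mu>22) (triangular_frame \<alpha> \<beta> \<gamma>)"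
proof -
  note s = smooth_metric_coefficients[OF m]
  \<comment> \<open>The squared length of \<open>(- \<mu>12, \<mu>11)\<close>: it equals
    \<open>\<mu>11\<close> times the determinant of the metric.\<close>
  define q where "q x = \<mu>11 x * (\<mu>11 x * \<mu>22 x - \<mu>12 x * \<mu>12 x)" for x
  have p: "\<mu>11 x > 0" for x
    using riemannian_metricD(4)[OF m, of "axis 1 1" x] by (simp add: metric_of_eq axis_def vec_eq_iff)
  have q: "q x > 0" for x
  proof -
    have "vector [- \<mu>12 x, \<mu>11 x] \<noteq> (0::real^2)"
      using p[of x] by (simp add: vec_eq_iff forall_2)
    from riemannian_metricD(4)[OF m this, of x] show ?thesis
      by (simp add: metric_of_eq q_def algebra_simps)
  qed
  have sq: "smooth q"
    unfolding q_def by (intro smooth_mult smooth_diff s)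
  \<comment> \<open>Inverse square roots, written with \<open>powr\<close> so that
    \<open>smooth_powr\<close> applies.\<close>
  define \<alpha> k where "\<alpha> x = \<mu>11 x powr (-1/2)" and "k x = q x powr (-1/2)" for x
  have "smooth \<alpha>" "smooth k"
    unfolding \<alpha>_def k_def using smooth_powr[OF s(1) p] smooth_powr[OF sq q] by auto
  have "\<alpha> x > 0" "k x > 0" for x
    using p[of x] q[of x] by (simp_all add: \<alpha>_def k_def)
  have inv_sqrt: "y * (y powr (-1/2) * y powr (-1/2)) = 1" if "y > 0" for y :: real
  proof -
    have "y powr (-1/2) * y powr (-1/2) = y powr (-1)"
      by (simp flip: powr_add)
    then show ?thesis
      using that by (simp add: powr_minus_divide)
  qed
  have a2: "\<mu>11 x * (\<alpha> x * \<alpha> x) = 1" for x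
    unfolding \<alpha>_def by (rule inv_sqrt[OF p])
  have k2: "q x * (k x * k x) = 1" for x
    unfolding k_def by (rule inv_sqrt[OF q])
  have "metric_of \<mu>11 \<mu>12 \<mu>22 x ((- \<mu>12 x * k x) *\<^sub>R axis 1 1 + (\<mu>11 x * k x) *\<^sub>R axis 2 1)
      ((- \<mu>12 x * k x) *\<^sub>R axis 1 1 + (\<mu>11 x * k x) *\<^sub>R axis 2 1) = 1" for x
    using k2[of x] by (simp add: metric_of_eq axis_def q_def algebra_simps)
  moreover have "smooth (\<lambda>x. \<alpha> x *\<^sub>R (axis 1 1 :: real^2))"
    "smooth (\<lambda>x. (- \<mu>12 x * k x) *\<^sub>R axis 1 1 + (\<mu>11 x * k x) *\<^sub>R (axis 2 1 :: real^2))"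
    by (intro smooth_add smooth_scaleR smooth_mult smooth_uminus smooth_const s
        \<open>smooth \<alpha>\<close> \<open>smooth k\<close>)+
  ultimately have "orthonormal_frame (metric_of \<mu>11 \<mu>12 \<mu>22)
      (triangular_frame \<alpha> (\<lambda>x. - \<mu>12 x * k x) (\<lambda>x. \<mu>11 x * k x))"
    unfolding triangular_frame_def orthonormal_frame_def Basis_vec2
    using a2 axis_2_neq_axis_1 by (auto simp: metric_of_eq axis_def algebra_simps)
  moreover have "\<forall>x. \<alpha> x > 0 \<and> \<mu>11 x * k x > 0"
    using \<open>\<And>x. \<alpha> x > 0\<close> \<open>\<And>x. k x > 0\<close> p by simp
  ultimately show ?thesis
    by (intro exI conjI)
qed

text \<open>In a triangular frame the Lee form is a combination of the two defects \<open>r1\<close>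
  and \<open>r2\<close>; positivity of \<alpha> and \<gamma> makes the resulting linear system
  invertible.\<close>

lemma balanced_iff_partial:
  assumes m: "riemannian_metric (metric_of \<mu>11 \<mu>12 \<mu>22)"
  shows "balanced (J1 canonical_connection) (g1 canonical_connection (metric_of \<mu>11 \<mu>12 \<mu>22)) \<longleftrightarrow>
    (\<forall>x. partial 2 \<mu>11 x = partial 1 \<mu>12 x \<and> partial 1 \<mu>22 x = partial 2 \<mu>12 x)"
proof -
  let ?J = "J1 canonical_connection" and ?g = "g1 canonical_connection (metric_of \<mu>11 \<mu>12 \<mu>22)"
  obtain \<alpha> \<beta> \<gamma> :: "real^2 \<Rightarrow> real" where pos: "\<And>x. \<alpha> x > 0" "\<And>x. \<gamma> x > 0"
    and e: "orthonormal_frame (metric_of \<mu>11 \<mu>12 \<mu>22) (triangular_frame \<alpha> \<beta> \<gamma>)"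
    using triangular_orthonormal_frame_exists[OF m] by blast
  define r1 where "r1 x = partial 1 \<mu>12 x - partial 2 \<mu>11 x" for x
  define r2 where "r2 x = partial 1 \<mu>22 x - partial 2 \<mu>12 x" for x
  \<comment> \<open>For a frame vector \<open>e\<close> the summand is skew under exchanging the
    direction of differentiation with the first slot. In the plane this leaves the factor
    \<open>Z$1 * e$2 - Z$2 * e$1\<close> times \<open>e$1 * r1 + e$2 * r2\<close>.\<close>
  have lee: "lee_form ?J ?g Z (x, u) =
      - (fst (Z (x, u)) $ 2) * (\<alpha> x * \<alpha> x) * r1 x +
      (fst (Z (x, u)) $ 1 * \<gamma> x - fst (Z (x, u)) $ 2 * \<beta> x) * (\<beta> x * r1 x + \<gamma> x * r2 x)"
    if "smooth Z" for Z x u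
    unfolding lee_form_canonical[OF m e that] Basis_vec2 form_deriv_metric_of[OF m] r1_def r2_def
      triangular_frame_def
    by (simp add: axis_2_neq_axis_1 axis_2_neq_axis_1[symmetric] axis_nth_2) (simp add: algebra_simps)
  show ?thesis
  proof
    assume bal: "balanced ?J ?g"
    show "\<forall>x. partial 2 \<mu>11 x = partial 1 \<mu>12 x \<and> partial 1 \<mu>22 x = partial 2 \<mu>12 x"
    proof
      fix x
      have z: "lee_form ?J ?g (\<lambda>_. (vector [a, b], 0)) (x, 0) = 0" for a b
        using bal smooth_const unfolding balanced_def by blast
      \<comment> \<open>The test vector is the second frame vector: it annihilates the second term
        and leaves a nonzero multiple of \<open>r1 x\<close>.\<close>
      have "r1 x = 0"
        using z[of "\<beta> x" "\<gamma> x"] pos[of x] by (simp add: lee[OF smooth_const] algebra_simps)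
      \<comment> \<open>With \<open>r1 x = 0\<close>, the first coordinate vector leaves \<gamma>
        squared times \<open>r2 x\<close>.\<close>
      moreover have "r2 x = 0"
        using z[of 1 0] pos[of x] \<open>r1 x = 0\<close> by (simp add: lee[OF smooth_const])
      ultimately show "partial 2 \<mu>11 x = partial 1 \<mu>12 x \<and> partial 1 \<mu>22 x = partial 2 \<mu>12 x"
        by (simp add: r1_def r2_def)
    qed
  next
    assume "\<forall>x. partial 2 \<mu>11 x = partial 1 \<mu>12 x \<and> partial 1 \<mu>22 x = partial 2 \<mu>12 x"
    then show "balanced ?J ?g"
      unfolding balanced_def by (auto simp: lee r1_def r2_def)
  qed
qed

section \<open>Restriction to coordinate lines and integration\<close>

lemma vector_2_axis: "vector [a, b] = a *\<^sub>R axis 1 1 + b *\<^sub>R (axis 2 1 :: real^2)"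
  by (simp add: vec_eq_iff forall_2 axis_def)

lemma has_vector_derivative_partial:
  fixes f :: "real^2 \<Rightarrow> real"
  assumes "smooth f"
  shows "((\<lambda>t. f (vector [a, t])) has_vector_derivative partial 2 f (vector [a, t])) (at t)"
    and "((\<lambda>t. f (vector [t, a])) has_vector_derivative partial 1 f (vector [t, a])) (at t)"
proof -
  have 1: "((\<lambda>t. f (u + t *\<^sub>R w)) has_vector_derivative frechet_derivative f (at (u + t *\<^sub>R w)) w) (at t)" for u w
  proof -
    have "((\<lambda>t. u + t *\<^sub>R w) has_vector_derivative w) (at t)"
      by (auto intro!: derivative_eq_intros)
    from vector_derivative_diff_chain_within[OF this, of f]
    show ?thesis
      using has_derivative_at_withinI[OF smooth_has_derivative[OF assms]] by (auto simp: o_def)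
  qed
  show "((\<lambda>t. f (vector [a, t])) has_vector_derivative partial 2 f (vector [a, t])) (at t)"
    unfolding vector_2_axis partial_def by (rule 1)
  show "((\<lambda>t. f (vector [t, a])) has_vector_derivative partial 1 f (vector [t, a])) (at t)"
    using 1[of "a *\<^sub>R axis 2 1" "axis 1 1"] unfolding vector_2_axis partial_def by (simp add: add.commute)
qed

lemma smooth_partial: "smooth f \<Longrightarrow> smooth (partial i f)"
  using smooth_frechet_derivative[of f "axis i 1"] by (simp add: partial_def[abs_def])

lemma continuous_on_vector2:
  fixes f :: "real^2 \<Rightarrow> real"
  assumes "smooth f"
  shows "continuous_on S (\<lambda>t. f (vector [a, t]))" "continuous_on S (\<lambda>t. f (vector [t, a]))"
  unfolding vector_2_axis
  by (auto intro!: continuous_on_compose2[OF smooth_continuous[OF assms]] continuous_intros)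

lemma LBINT_has_vector_derivative:
  fixes f :: "real \<Rightarrow> real"
  assumes "continuous_on UNIV f"
  shows "((\<lambda>u. LBINT t=0..u. f t) has_vector_derivative f x) (at x)"
proof -
  \<comment> \<open>The fundamental theorem gives a derivative within a compact interval; this one
    contains 0 and has \<open>x\<close> in its interior, so the restriction disappears.\<close>
  let ?a = "- \<bar>x\<bar> - 1" and ?b = "\<bar>x\<bar> + 1"
  have "((\<lambda>u. LBINT t=ereal 0..u. f t) has_vector_derivative f x) (at x within {?a..?b})"
    by (rule interval_integral_FTC2) (auto intro: continuous_on_subset[OF assms])
  moreover have "at x within {?a..?b} = at x"
    by (rule at_within_Icc_at) auto
  ultimately show ?thesis
    by (simp add: zero_ereal_def)
qed

text \<open>Both directions of the fundamental theorem of calculus. The second fact fixes the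
  constant as the value at 0, which supplies the witnesses in the final proof.\<close>

lemma primitive_iff_vector_derivative:
  fixes F f :: "real \<Rightarrow> real"
  assumes F: "\<And>t. (F has_vector_derivative F' t) (at t)" and f: "continuous_on UNIV f"
  shows "(\<exists>c. \<forall>u. F u = c + (LBINT t=0..u. f t)) \<longleftrightarrow> F' = f"
    "F' = f \<Longrightarrow> F u = F 0 + (LBINT t=0..u. f t)"
proof -
  show 1: "F u = F 0 + (LBINT t=0..u. f t)" if "F' = f" for u
  proof -
    have "(LBINT t=ereal 0..ereal u. f t) = F u - F 0"
      by (rule interval_integral_FTC_finite)
        (use F that in \<open>auto intro: continuous_on_subset[OF f] has_vector_derivative_at_within\<close>)
    then show ?thesis
      by (simp add: zero_ereal_def)
  qed
  show "(\<exists>c. \<forall>u. F u = c + (LBINT t=0..u. f t)) \<longleftrightarrow> F' = f"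
  proof
    assume "\<exists>c. \<forall>u. F u = c + (LBINT t=0..u. f t)"
    then obtain c where c: "F = (\<lambda>u. c + (LBINT t=0..u. f t))"
      by auto
    have "(F has_vector_derivative 0 + f t) (at t)" for t
      unfolding c by (rule has_vector_derivative_add[OF has_vector_derivative_const LBINT_has_vector_derivative[OF f]])
    then show "F' = f"
      using F vector_derivative_unique_at by fastforce
  qed (use 1 in blast)
qed

theorem theorem6p2:
  fixes \<mu>11 \<mu>12 \<mu>22 :: "real^2 \<Rightarrow> real"
  assumes "riemannian_metric (metric_of \<mu>11 \<mu>12 \<mu>22)"
  shows "balanced (J1 canonical_connection)
           (g1 canonical_connection (metric_of \<mu>11 \<mu>12 \<mu>22)) \<longleftrightarrow>
         (\<exists>(\<nu> :: real^2 \<Rightarrow> real) (f :: real \<Rightarrow> real) (h :: real \<Rightarrow> real).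
            smooth \<nu> \<and> smooth f \<and> smooth h \<and>
            \<mu>12 = \<nu> \<and>
            (\<forall>x1 x2. \<mu>11 (vector [x1, x2]) = f x1 + (LBINT t=0..x2. partial 1 \<nu> (vector [x1, t]))) \<and>
            (\<forall>x1 x2. \<mu>22 (vector [x1, x2]) = h x2 + (LBINT t=0..x1. partial 2 \<nu> (vector [t, x2]))))"
  (is "?bal \<longleftrightarrow> ?rhs")
proof -
  note s = smooth_metric_coefficients[OF assms]
  \<comment> \<open>On each line where one coordinate is fixed, an integral formula with a free
    constant is equivalent to one of the two differential equations.\<close>
  note p11 = primitive_iff_vector_derivative[OF has_vector_derivative_partial(1)[OF s(1)]
      continuous_on_vector2(1)[OF smooth_partial[OF s(2), of 1]]]
  note p22 = primitive_iff_vector_derivative[OF has_vector_derivative_partial(2)[OF s(3)]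
      continuous_on_vector2(2)[OF smooth_partial[OF s(2), of 2]]]
  have ext: "(\<forall>x. P x) \<longleftrightarrow> (\<forall>a b. P (vector [a, b]))" for P :: "real^2 \<Rightarrow> bool"
    by (metis vector_2_axis forall_vector_2)
  have bal: "?bal \<longleftrightarrow> (\<forall>a b. partial 2 \<mu>11 (vector [a, b]) = partial 1 \<mu>12 (vector [a, b])) \<and>
      (\<forall>a b. partial 1 \<mu>22 (vector [a, b]) = partial 2 \<mu>12 (vector [a, b]))"
    unfolding balanced_iff_partial[OF assms] by (subst ext) blast
  show ?thesis
  proof
    assume ?bal
    \<comment> \<open>Integration starts at 0, so the free functions are the restrictions of \<mu>11
      and \<mu>22 to the coordinate axes; these are composites with linear maps, hence
      smooth.\<close>
    define f where "f a = \<mu>11 (vector [a, 0])" for a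
    define h where "h b = \<mu>22 (vector [0, b])" for b
    have "smooth f" "smooth h"
      unfolding f_def h_def vector_2_axis
      using smooth_compose_linear[OF bounded_linear_scaleR_left s(1)]
        smooth_compose_linear[OF bounded_linear_scaleR_left s(3)] by simp_all
    moreover have "\<mu>11 (vector [a, b]) = f a + (LBINT t=0..b. partial 1 \<mu>12 (vector [a, t]))" for a b
      unfolding f_def by (rule p11(2)) (use \<open>?bal\<close> bal in auto)
    moreover have "\<mu>22 (vector [a, b]) = h b + (LBINT t=0..a. partial 2 \<mu>12 (vector [t, b]))" for a b
      unfolding h_def by (rule p22(2)) (use \<open>?bal\<close> bal in auto)
    ultimately show ?rhs
      using s(2) by blast
  next
    assume ?rhs
    then obtain f h where
      "\<And>a b. \<mu>11 (vector [a, b]) = f a + (LBINT t=0..b. partial 1 \<mu>12 (vector [a, t]))"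
      "\<And>a b. \<mu>22 (vector [a, b]) = h b + (LBINT t=0..a. partial 2 \<mu>12 (vector [t, b]))"
      by metis
    \<comment> \<open>For fixed \<open>a\<close> the values \<open>f a\<close> and
      \<open>h a\<close> are constants in \<open>t\<close>, so they witness the left-hand sides of
      \<open>p11(1)\<close> and \<open>p22(1)\<close>.\<close>
    then have "(\<lambda>t. partial 2 \<mu>11 (vector [a, t])) = (\<lambda>t. partial 1 \<mu>12 (vector [a, t]))"
      "(\<lambda>t. partial 1 \<mu>22 (vector [t, a])) = (\<lambda>t. partial 2 \<mu>12 (vector [t, a]))" for a
      using p11(1)[of a] p22(1)[of a] by blast+
    then show ?bal
      unfolding bal by (auto simp: fun_eq_iff)
  qed
qed

end
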